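(* Let $\ell\ge2$ be an integer and let $\tau:\mathbb{R}/\mathbb{Z}\to\mathbb{R}$ be a non-constant Lipschitz function such that $\int_{\mathbb{R}/\mathbb{Z}}\tau=0$. Then there exist an integer $m\ge0$ and a Lipschitz function $\mu:\mathbb{R}/\mathbb{Z}\to\mathbb{R}$ such that $\mathcal{L}_1^m\mu=\tau$ and $\int_{\mathbb{R}/\mathbb{Z}}\mu=0$, but $\mathcal{L}_1\rho\ne\mu$ for all Lipschitz functions $\rho:\mathbb{R}/\mathbb{Z}\to\mathbb{R}$.
   Context: $\mathcal{L}_1\mu=\mu\circ\mathbf{m}_\ell-\mu$, where $\mathbf{m}_\ell:\mathbb{R}/\mathbb{Z}\to\mathbb{R}/\mathbb{Z}$ is $\theta\mapsto\ell\theta$; $\mathcal{L}_1^m$ is the $m$-fold iterate ($\mathcal{L}_1^0$ is the identity). Integrals are with respect to Lebesgue measure. *)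

theory Defs
  imports "HOL-Analysis.Analysis"
begin

section \<open>The circle as the quotient of the reals by the integers\<close>

quotient_type circle = real / "\<lambda>x y :: real. x - y \<in> \<int>"
  morphisms rep_circle to_circle
proof (rule equivpI)
  show "reflp (\<lambda>x y :: real. x - y \<in> \<int>)"
    by (simp add: reflp_def)
  show "symp (\<lambda>x y :: real. x - y \<in> \<int>)"
  proof (rule sympI)
    fix x y :: real
    assume "x - y \<in> \<int>"
    then have "- (x - y) \<in> \<int>" by (rule Ints_minus)
    then show "y - x \<in> \<int>" by simp
  qed
  show "transp (\<lambda>x y :: real. x - y \<in> \<int>)"
  proof (rule transpI)
    fix x y z :: real
    assume "x - y \<in> \<int>" "y - z \<in> \<int>"
    then have "(x - y) + (y - z) \<in> \<int>" by (rule Ints_add)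
    then show "x - z \<in> \<int>" by simp
  qed
qed

lemma to_circle_eq_iff: "to_circle x = to_circle y \<longleftrightarrow> x - y \<in> \<int>"
  by (rule circle.abs_eq_iff)

lemma to_circle_cases:
  obtains x where "p = to_circle x"
  by (metis Quotient3_abs_rep Quotient3_circle)

text \<open>The quotient metric: the distance of two points is the distance of the corresponding
  cosets of the integers, as subsets of the real line.\<close>

instantiation circle :: metric_space
begin

definition dist_circle :: "circle \<Rightarrow> circle \<Rightarrow> real" where
  "dist_circle p q = setdist (to_circle -` {p}) (to_circle -` {q})"

definition uniformity_circle :: "(circle \<times> circle) filter" where
  "uniformity_circle = (INF e\<in>{0<..}. principal {(x, y). dist x y < e})"

definition open_circle :: "circle set \<Rightarrow> bool" where
  "open_circle U \<longleftrightarrow> (\<forall>x\<in>U. eventually (\<lambda>(x', y). x' = x \<longrightarrow> y \<in> U) uniformity)"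

lemma dist_to_circle:
  "dist (to_circle x) (to_circle y) = \<bar>x - y - of_int (round (x - y))\<bar>"
proof -
  have "setdist (to_circle -` {to_circle x}) (to_circle -` {to_circle y})
      \<le> dist (x - of_int (round (x - y))) y"
    by (rule setdist_le_dist) (auto simp: to_circle_eq_iff)
  moreover have "\<bar>x - y - of_int (round (x - y))\<bar>
      \<le> setdist (to_circle -` {to_circle x}) (to_circle -` {to_circle y})"
  proof (rule le_setdistI)
    show "to_circle -` {to_circle x} \<noteq> {}" "to_circle -` {to_circle y} \<noteq> {}" by auto
  next
    fix a b
    assume "a \<in> to_circle -` {to_circle x}" "b \<in> to_circle -` {to_circle y}"
    then obtain i j where "a - x = of_int i" "b - y = of_int j"
      by (auto simp: to_circle_eq_iff elim!: Ints_cases)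
    then have "a - b = x - y - of_int (j - i)" by simp
    then show "\<bar>x - y - of_int (round (x - y))\<bar> \<le> dist a b"
      using round_diff_minimal[of "x - y" "j - i"] by (simp add: dist_real_def)
  qed
  ultimately show ?thesis
    by (simp add: dist_circle_def dist_real_def algebra_simps)
qed

instance
proof
  fix p q r :: circle
  obtain x y z where *: "p = to_circle x" "q = to_circle y" "r = to_circle z"
    by (metis to_circle_cases)
  show "dist p q = 0 \<longleftrightarrow> p = q"
  proof
    assume "dist p q = 0"
    then have "x - y = of_int (round (x - y))" by (simp add: * dist_to_circle)
    then show "p = q" by (metis * to_circle_eq_iff Ints_of_int)
  next
    assume "p = q"
    then show "dist p q = 0" by (auto simp: * dist_to_circle to_circle_eq_iff elim!: Ints_cases)
  qed
  have "\<bar>x - y - of_int (round (x - y))\<bar>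
      \<le> \<bar>x - y - of_int (round (x - z) - round (y - z))\<bar>"
    by (rule round_diff_minimal)
  then show "dist p q \<le> dist p r + dist q r"
    by (simp add: * dist_to_circle)
qed (simp_all only: uniformity_circle_def open_circle_def)

end

lemma dist_to_circle_le: "dist (to_circle x) (to_circle y) \<le> \<bar>x - y\<bar>"
  using round_diff_minimal[of "x - y" 0] by (simp add: dist_to_circle)

lemma continuous_on_to_circle: "continuous_on A to_circle"
  unfolding continuous_on_iff
  by (metis dist_real_def dist_to_circle_le le_less_trans)

lemma borel_measurable_to_circle [measurable]: "to_circle \<in> borel_measurable borel"
  by (rule borel_measurable_continuous_onI) (rule continuous_on_to_circle)

definition circle_lebesgue :: "circle measure" where
  "circle_lebesgue = distr (restrict_space lborel {0..<1}) borel to_circle"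

lemma integral_circle_lebesgue:
  fixes f :: "circle \<Rightarrow> real"
  assumes "f \<in> borel_measurable borel"
  shows "(LINT p|circle_lebesgue. f p) = (LINT x:{0..<1}|lborel. f (to_circle x))"
proof -
  have "to_circle \<in> measurable (restrict_space lborel {0..<1}) borel"
    by (rule measurable_restrict_space1) simp
  then show ?thesis
    using assms
    by (simp add: circle_lebesgue_def integral_distr integral_restrict_space
        set_lebesgue_integral_def)
qed

section \<open>Lipschitz functions and the cohomological operator\<close>

definition lipschitz_fun :: "('a :: metric_space \<Rightarrow> 'b :: metric_space) \<Rightarrow> bool" where
  "lipschitz_fun f \<longleftrightarrow> (\<exists>C. C-lipschitz_on UNIV f)"

lift_definition circle_times :: "nat \<Rightarrow> circle \<Rightarrow> circle" is "\<lambda>l x. real l * x"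
proof -
  fix l :: nat and x y :: real
  assume "x - y \<in> \<int>"
  then have "real l * (x - y) \<in> \<int>" by (intro Ints_mult Ints_of_nat)
  then show "real l * x - real l * y \<in> \<int>" by (simp add: right_diff_distrib)
qed

definition L1 :: "nat \<Rightarrow> (circle \<Rightarrow> real) \<Rightarrow> circle \<Rightarrow> real" where
  "L1 l \<mu> = (\<lambda>\<theta>. \<mu> (circle_times l \<theta>) - \<mu> \<theta>)"

end

theory Submission
  imports Defs "HOL-Complex_Analysis.Complex_Analysis" "HOL-Library.Periodic_Fun"
begin

text \<open>
  Lift functions on the circle to 1-periodic functions on the real line and let
  \<open>P f x = (1 / l) * (\<Sum>j<l. f ((x + j) / l))\<close> be the transfer operator, which divides Lipschitz
  constants by \<open>l\<close> and is a left inverse of \<open>U f x = f (l * x)\<close>. For fixed \<open>x\<close>, the numbers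
  \<open>c k = (P ^^ k) f x - (P ^^ Suc k) f (l * x)\<close> are \<open>O(l powr - k)\<close>, so their generating function is
  holomorphic on the disc of radius \<open>l > 1\<close>. Replacing \<open>f\<close> by \<open>U f - f\<close> multiplies the generating
  function by \<open>z - 1\<close>. A function in the range of all the iterates of \<open>U - id\<close> thus has a
  generating function vanishing to infinite order at \<open>1\<close>, so all \<open>c k\<close> vanish; then
  \<open>f x = (P ^^ k) f (l ^ k * x)\<close> oscillates by \<open>O(l powr - k)\<close> for every \<open>k\<close> and is constant.
\<close>

section \<open>Power series divisible by all powers of \<open>z - 1\<close>\<close>

text \<open>A nonzero holomorphic function has a zero of finite order only, and 1 lies inside the
  disc of convergence. The quotient \<open>G\<close> and its radius may depend on \<open>m\<close>,
  so the factorisations are compared only near 1; connectedness of the disc does the rest.\<close>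

lemma fps_eq_0_if_infinite_order_at_1:
  fixes F :: "complex fps"
  assumes dvd: "\<And>m. \<exists>G. fps_conv_radius G > 1 \<and> F = (fps_X - 1) ^ m * G"
  shows "F = 0"
proof -
  have rad: "fps_conv_radius F > 1"
    using dvd[of 0] by auto
  have eval: "\<exists>G. fps_conv_radius G > 1 \<and>
      (\<forall>z. norm z < fps_conv_radius G \<longrightarrow> eval_fps F z = (z - 1) ^ m * eval_fps G z)" for m
  proof -
    from dvd[of m] obtain G where G: "fps_conv_radius G > 1" "F = (fps_X - 1) ^ m * G"
      by blast
    have X1: "fps_conv_radius (fps_X - 1 :: complex fps) = \<infinity>"
      using fps_conv_radius_diff[of "fps_X :: complex fps" 1] by simp
    then have X1m: "fps_conv_radius ((fps_X - 1 :: complex fps) ^ m) = \<infinity>"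
      using fps_conv_radius_power[of "fps_X - 1 :: complex fps" m] by simp
    have "eval_fps F z = (z - 1) ^ m * eval_fps G z" if "norm z < fps_conv_radius G" for z
      using that by (simp add: G(2) eval_fps_mult eval_fps_power eval_fps_diff X1 X1m)
    with G(1) show ?thesis by blast
  qed
  define S where "S = eball (0::complex) (fps_conv_radius F)"
  have S: "open S" "connected S" "1 \<in> S" "0 \<in> S"
    using rad order.strict_trans[OF _ rad, of 0]
    by (auto simp: S_def in_eball_iff connected_eball simp flip: one_ereal_def zero_ereal_def)
  have hol: "eval_fps F holomorphic_on S"
    by (rule holomorphic_on_eval_fps) (simp add: S_def)
  have zero: "eval_fps F 1 = 0"
    using eval[of 1] by (auto simp flip: one_ereal_def)
  have "eval_fps F constant_on S"
  proof (rule ccontr)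
    assume nonconst: "\<not> eval_fps F constant_on S"
    obtain g r n where g: "0 < n" "0 < r" "ball 1 r \<subseteq> S" "g holomorphic_on ball 1 r"
        "\<And>w. w \<in> ball 1 r \<Longrightarrow> eval_fps F w = (w - 1) ^ n * g w"
        "\<And>w. w \<in> ball 1 r \<Longrightarrow> g w \<noteq> 0"
      using holomorphic_factor_zero_nonconstant[OF hol S(1-3) zero nonconst] by metis
    \<comment> \<open>\<open>n\<close> is the exact order of the zero at 1. One power more leaves a
      factor \<open>z - 1\<close> in \<open>g\<close>, which forces \<open>g 1 = 0\<close>.\<close>
    obtain G where G: "fps_conv_radius G > 1"
        "\<And>z. norm z < fps_conv_radius G \<Longrightarrow> eval_fps F z = (z - 1) ^ Suc n * eval_fps G z"
      using eval[of "Suc n"] by blast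
    define T where "T = eball (0::complex) (fps_conv_radius G)"
    have T: "open T" "1 \<in> T"
      using G(1) by (auto simp: T_def in_eball_iff simp flip: one_ereal_def)
    have "continuous_on T (eval_fps G)"
      unfolding T_def by (rule continuous_on_eval_fps)
    then have "isCont (eval_fps G) 1"
      using T continuous_on_eq_continuous_at by blast
    then have lim: "((\<lambda>z. (z - 1) * eval_fps G z) \<longlongrightarrow> (1 - 1) * eval_fps G 1) (at 1)"
      unfolding isCont_def by (intro tendsto_intros)
    have "(g \<longlongrightarrow> g 1) (at 1)"
      using g(2,4) holomorphic_on_imp_continuous_on continuous_on_eq_continuous_at[of "ball 1 r" g]
      by (metis centre_in_ball isCont_def open_ball)
    moreover have "eventually (\<lambda>z. g z = (z - 1) * eval_fps G z) (at 1)"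
    proof -
      \<comment> \<open>The point 1 is removed so that \<open>(z - 1) ^ n\<close> can be
        cancelled.\<close>
      have "eventually (\<lambda>z. z \<in> ball 1 r \<inter> T - {1}) (at 1)"
        using g(2) T by (intro eventually_at_in_open) auto
      then show ?thesis
      proof eventually_elim
        case (elim z)
        then have "(z - 1) ^ n * g z = (z - 1) ^ n * ((z - 1) * eval_fps G z)"
          using g(5)[of z] G(2)[of z] by (auto simp: T_def in_eball_iff)
        then show ?case using elim by auto
      qed
    qed
    ultimately have "((\<lambda>z. (z - 1) * eval_fps G z) \<longlongrightarrow> g 1) (at 1)"
      by (rule Lim_transform_eventually)
    with lim have "g 1 = (1 - 1) * eval_fps G 1"
      by (rule LIM_unique[rotated])
    then show False using g(2) g(6)[of 1] by simp
  qed
  then have "eval_fps F z = 0" if "z \<in> S" for z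
    using zero that S(3) unfolding constant_on_def by metis
  then have "eventually (\<lambda>z. eval_fps F z = eval_fps 0 z) (nhds 0)"
    using eventually_nhds_in_open[OF S(1,4)] by (auto elim: eventually_mono)
  then show ?thesis
    using rad order.strict_trans[OF _ rad, of 0] by (intro eval_fps_eqD) auto
qed

section \<open>The transfer operator\<close>

definition transfer :: "nat \<Rightarrow> (real \<Rightarrow> real) \<Rightarrow> real \<Rightarrow> real" where
  "transfer l f x = (\<Sum>j<l. f ((x + real j) / real l)) / real l"

lemma transfer_diff: "transfer l (\<lambda>x. f x - g x) = (\<lambda>x. transfer l f x - transfer l g x)"
  by (simp add: transfer_def fun_eq_iff sum_subtractf diff_divide_distrib)

lemma transfer_funpow_diff:
  "(transfer l ^^ k) (\<lambda>x. f x - g x) = (\<lambda>x. (transfer l ^^ k) f x - (transfer l ^^ k) g x)"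
  by (induction k) (simp_all add: transfer_diff)

text \<open>Each inverse branch of the dilation contracts distances by the factor \<open>l\<close>,
  and averaging over the branches keeps the Lipschitz constant.\<close>

lemma transfer_lipschitz:
  assumes "C-lipschitz_on UNIV f"
  shows "(C / real l)-lipschitz_on UNIV (transfer l f)"
proof (cases "l = 0")
  \<comment> \<open>Division by zero gives 0, so both \<open>transfer l f\<close> and the claimed
    constant vanish.\<close>
  case True
  then show ?thesis by (auto simp: transfer_def intro!: lipschitz_onI)
next
  case False
  have C: "0 \<le> C" using assms by (rule lipschitz_on_nonneg)
  show ?thesis
  proof (rule lipschitz_onI)
    fix x y :: real
    have "\<bar>transfer l f x - transfer l f y\<bar>
        = \<bar>\<Sum>j<l. f ((x + real j) / real l) - f ((y + real j) / real l)\<bar> / real l"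
      by (simp add: transfer_def sum_subtractf abs_divide flip: diff_divide_distrib)
    also have "\<dots> \<le> (\<Sum>j<l. \<bar>f ((x + real j) / real l) - f ((y + real j) / real l)\<bar>) / real l"
      by (intro divide_right_mono sum_abs) simp
    also have "\<dots> \<le> (\<Sum>j<l. C / real l * \<bar>x - y\<bar>) / real l"
    proof (intro divide_right_mono sum_mono)
      fix j
      have "\<bar>f ((x + real j) / real l) - f ((y + real j) / real l)\<bar>
          \<le> C * \<bar>(x + real j) / real l - (y + real j) / real l\<bar>"
        using lipschitz_onD[OF assms] by (simp add: dist_real_def)
      also have "(x + real j) / real l - (y + real j) / real l = (x - y) / real l"
        by (simp add: diff_divide_distrib add_divide_distrib)
      finally show "\<bar>f ((x + real j) / real l) - f ((y + real j) / real l)\<bar>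
          \<le> C / real l * \<bar>x - y\<bar>"
        by (simp add: abs_divide)
    qed simp
    also have "\<dots> = C / real l * \<bar>x - y\<bar>"
      using False by simp
    finally show "dist (transfer l f x) (transfer l f y) \<le> C / real l * dist x y"
      by (simp add: dist_real_def)
  qed (use C in simp)
qed

lemma transfer_funpow_lipschitz:
  assumes "C-lipschitz_on UNIV f"
  shows "(C / real l ^ k)-lipschitz_on UNIV ((transfer l ^^ k) f)"
proof (induction k)
  case (Suc k)
  then show ?case
    using transfer_lipschitz[OF Suc, of l] by (simp add: mult.commute)
qed (use assms in simp)

text \<open>Translating by 1 permutes the branches cyclically: branch \<open>j\<close> becomes
  branch \<open>j + 1\<close>, and branch \<open>l\<close> agrees with branch 0 by
  periodicity.\<close>

lemma transfer_periodic:
  assumes "l > 0" "\<And>x. f (x + 1) = f x"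
  shows "transfer l f (x + 1) = transfer l f x"
proof -
  let ?g = "\<lambda>j. f ((x + real j) / real l)"
  have "?g l = ?g 0"
    using assms(2)[of "x / real l"] assms(1) by (simp add: add_divide_distrib)
  moreover have "(\<Sum>j<l. ?g (Suc j)) + ?g 0 = (\<Sum>j<l. ?g j) + ?g l"
    using sum.lessThan_Suc_shift[of ?g l] by simp
  ultimately have "(\<Sum>j<l. ?g (Suc j)) = (\<Sum>j<l. ?g j)" by simp
  then show ?thesis by (simp add: transfer_def ac_simps)
qed

lemma transfer_funpow_periodic:
  assumes "l > 0" "\<And>x. f (x + 1) = f x"
  shows "(transfer l ^^ k) f (x + 1) = (transfer l ^^ k) f x"
  using assms by (induction k arbitrary: x) (simp_all add: transfer_periodic)

text \<open>Multiplying \<open>(x + j) / l\<close> by \<open>l\<close> gives \<open>x + j\<close>,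
  so periodicity makes all \<open>l\<close> summands equal to \<open>f x\<close>.\<close>

lemma transfer_dilate:
  assumes "l > 0" "\<And>x. f (x + 1) = f x"
  shows "transfer l (\<lambda>x. f (real l * x)) = f"
proof
  fix x
  interpret periodic_fun_simple' f by standard (rule assms(2))
  show "transfer l (\<lambda>x. f (real l * x)) x = f x"
    using assms(1) by (simp add: transfer_def plus_of_nat)
qed

lemma periodic_lipschitz_oscillation:
  assumes "C-lipschitz_on UNIV f" "\<And>x :: real. f (x + 1) = f x"
  shows "\<bar>f x - f y :: real\<bar> \<le> C"
proof -
  interpret periodic_fun_simple' f by standard (rule assms(2))
  \<comment> \<open>An integer translate of \<open>y\<close> with \<open>x - y'\<close> in the
    interval [0,1).\<close>
  define y' where "y' = y + of_int \<lfloor>x - y\<rfloor>"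
  have "\<bar>f x - f y'\<bar> \<le> C * \<bar>x - y'\<bar>"
    using lipschitz_onD[OF assms(1)] by (simp add: dist_real_def)
  also have "\<dots> \<le> C * 1"
    using lipschitz_on_nonneg[OF assms(1)] unfolding y'_def by (intro mult_left_mono) linarith+
  finally show ?thesis by (simp add: y'_def plus_of_int)
qed

section \<open>The generating function of the defects\<close>

text \<open>With P the transfer operator and U the dilation, this is (id - U P) P^k f at
  \<open>x\<close>. Since P U = id on periodic functions, id - U P is there the projection onto the
  kernel of P along the range of U.\<close>

definition transfer_defect :: "nat \<Rightarrow> (real \<Rightarrow> real) \<Rightarrow> real \<Rightarrow> nat \<Rightarrow> real" where
  "transfer_defect l f x k = (transfer l ^^ k) f x - (transfer l ^^ Suc k) f (real l * x)"

definition defect_fps :: "nat \<Rightarrow> (real \<Rightarrow> real) \<Rightarrow> real \<Rightarrow> complex fps" where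
  "defect_fps l f x = Abs_fps (\<lambda>k. of_real (transfer_defect l f x k))"

text \<open>The subtracted term is the average of P^k f over the points \<open>x + j / l\<close>
  with \<open>j < l\<close>. These are at distance less than 1 from \<open>x\<close>, so the
  Lipschitz constant of P^k f bounds the difference.\<close>

lemma transfer_defect_bound:
  assumes "l > 0" "C-lipschitz_on UNIV f"
  shows "\<bar>transfer_defect l f x k\<bar> \<le> C / real l ^ k"
proof -
  define g where "g = (transfer l ^^ k) f"
  define D where "D = C / real l ^ k"
  have g: "D-lipschitz_on UNIV g"
    unfolding g_def D_def by (rule transfer_funpow_lipschitz[OF assms(2)])
  have D: "0 \<le> D" using g by (rule lipschitz_on_nonneg)
  have "transfer_defect l f x k = g x - (\<Sum>j<l. g (x + real j / real l)) / real l"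
    using assms(1) by (simp add: transfer_defect_def g_def transfer_def add_divide_distrib)
  also have "\<dots> = (\<Sum>j<l. g x - g (x + real j / real l)) / real l"
    using assms(1) by (simp add: sum_subtractf field_simps)
  finally have "\<bar>transfer_defect l f x k\<bar> = \<bar>\<Sum>j<l. g x - g (x + real j / real l)\<bar> / real l"
    by simp
  also have "\<dots> \<le> (\<Sum>j<l. \<bar>g x - g (x + real j / real l)\<bar>) / real l"
    by (intro divide_right_mono sum_abs) simp
  also have "\<dots> \<le> (\<Sum>j<l. D) / real l"
  proof (intro divide_right_mono sum_mono)
    fix j assume j: "j \<in> {..<l}"
    have "\<bar>g x - g (x + real j / real l)\<bar> \<le> D * \<bar>x - (x + real j / real l)\<bar>"
      using lipschitz_onD[OF g, of x "x + real j / real l"] by (simp add: dist_real_def)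
    also have "\<dots> \<le> D * 1"
      using D j by (intro mult_left_mono) auto
    finally show "\<bar>g x - g (x + real j / real l)\<bar> \<le> D" by simp
  qed simp
  finally show ?thesis using assms(1) by (simp add: D_def)
qed

lemma defect_fps_conv_radius:
  assumes "l \<ge> 2" "C-lipschitz_on UNIV f"
  shows "fps_conv_radius (defect_fps l f x) > 1"
proof -
  have C: "0 \<le> C" using assms(2) by (rule lipschitz_on_nonneg)
  \<comment> \<open>Any radius strictly between 1 and 2 would serve in place of 3/2; as
    \<open>l\<close> is at least 2, the ratio of the dominating geometric series is 3/4.\<close>
  have "norm (of_real (transfer_defect l f x k) * (3 / 2 :: complex) ^ k) \<le> C * (3 / 4) ^ k" for k
  proof -
    have "norm (of_real (transfer_defect l f x k) * (3 / 2 :: complex) ^ k)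
        \<le> C / real l ^ k * (3 / 2) ^ k"
      using mult_right_mono[OF transfer_defect_bound[OF _ assms(2), of l x k], of "(3 / 2) ^ k"]
        assms(1)
      by (simp add: norm_mult norm_power norm_divide)
    also have "\<dots> \<le> C / 2 ^ k * (3 / 2) ^ k"
      using assms(1) C by (intro mult_right_mono divide_left_mono power_mono) auto
    also have "\<dots> = C * (3 / 4) ^ k"
      by (simp add: power_divide flip: power_mult_distrib)
    finally show ?thesis .
  qed
  then have "summable (\<lambda>k. of_real (transfer_defect l f x k) * (3 / 2 :: complex) ^ k)"
    by (intro summable_comparison_test'[OF summable_mult[OF summable_geometric]]) auto
  then have "conv_radius (\<lambda>k. complex_of_real (transfer_defect l f x k)) \<ge> norm (3 / 2 :: complex)"
    by (rule conv_radius_geI)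
  moreover have "(1 :: ereal) < ereal (norm (3 / 2 :: complex))"
    by (simp add: norm_divide)
  ultimately show ?thesis
    unfolding fps_conv_radius_def defect_fps_def fps_nth_Abs_fps by (rule order.strict_trans2[rotated])
qed

lemma defect_fps_cohomological:
  assumes "l > 0" "\<And>x. f (x + 1) = f x"
  shows "defect_fps l (\<lambda>x. f (real l * x) - f x) x = (fps_X - 1) * defect_fps l f x"
proof (rule fps_ext)
  fix k
  let ?Uf = "\<lambda>x. f (real l * x)"
  \<comment> \<open>One application of the transfer operator undoes the dilation. This index shift
    is what becomes multiplication by \<open>fps_X\<close>.\<close>
  have shift: "(transfer l ^^ Suc k) ?Uf = (transfer l ^^ k) f" for k
    by (simp add: funpow_Suc_right transfer_dilate[of l f] assms del: funpow.simps)
  show "fps_nth (defect_fps l (\<lambda>x. f (real l * x) - f x) x) k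
      = fps_nth ((fps_X - 1) * defect_fps l f x) k"
  proof (cases k)
    \<comment> \<open>The dilated part has defect 0 at index 0, which matches the zero constant
      coefficient of a multiple of \<open>fps_X\<close>.\<close>
    case 0
    then show ?thesis
      using shift[of 0]
      by (simp add: defect_fps_def transfer_defect_def transfer_diff algebra_simps)
  next
    case (Suc n)
    have "transfer_defect l (\<lambda>x. ?Uf x - f x) x (Suc n)
        = transfer_defect l f x n - transfer_defect l f x (Suc n)"
      unfolding transfer_defect_def transfer_funpow_diff shift by simp
    then show ?thesis
      by (simp add: Suc defect_fps_def left_diff_distrib)
  qed
qed

lemma constant_if_transfer_defect_0:
  assumes "l \<ge> 2" "C-lipschitz_on UNIV f" "\<And>x. f (x + 1) = f x"
    and zero: "\<And>x k. transfer_defect l f x k = 0"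
  shows "f x = f y"
proof -
  have l: "l > 0" using assms(1) by simp
  \<comment> \<open>The defect of index \<open>k\<close> at the point \<open>real l ^ k * x\<close>
    is the step from \<open>k\<close> to \<open>Suc k\<close>.\<close>
  have rep: "f x = (transfer l ^^ k) f (real l ^ k * x)" for k x
  proof (induction k)
    case (Suc k)
    then show ?case
      using zero[of "real l ^ k * x" k] by (simp add: transfer_defect_def mult.assoc)
  qed simp
  have "\<bar>f x - f y\<bar> \<le> C / real l ^ k" for k
    unfolding rep[of x k] rep[of y k]
    by (rule periodic_lipschitz_oscillation[OF transfer_funpow_lipschitz[OF assms(2)]])
      (rule transfer_funpow_periodic, fact+)
  moreover have "(\<lambda>k. C / real l ^ k) \<longlonglongrightarrow> 0"
    using assms(1) by (intro LIMSEQ_divide_realpow_zero) auto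
  ultimately have "\<bar>f x - f y\<bar> \<le> 0"
    by (intro LIMSEQ_le_const) auto
  then show ?thesis by simp
qed

section \<open>Functions on the circle\<close>

lemma circle_lift_periodic: "\<mu> (to_circle (x + 1)) = \<mu> (to_circle x)"
proof -
  have "to_circle (x + 1) = to_circle x" by (simp add: to_circle_eq_iff)
  then show ?thesis by simp
qed

lemma circle_lift_lipschitz:
  assumes "C-lipschitz_on UNIV \<mu>"
  shows "C-lipschitz_on UNIV (\<lambda>x. \<mu> (to_circle x))"
proof (rule lipschitz_onI)
  fix x y
  have "dist (\<mu> (to_circle x)) (\<mu> (to_circle y)) \<le> C * dist (to_circle x) (to_circle y)"
    using lipschitz_onD[OF assms] by simp
  also have "\<dots> \<le> C * dist x y"
    using lipschitz_on_nonneg[OF assms] dist_to_circle_le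
    by (intro mult_left_mono) (simp_all add: dist_real_def)
  finally show "dist (\<mu> (to_circle x)) (\<mu> (to_circle y)) \<le> C * dist x y" .
qed (rule lipschitz_on_nonneg[OF assms])

lemma L1_to_circle: "L1 l \<mu> (to_circle x) = \<mu> (to_circle (real l * x)) - \<mu> (to_circle x)"
  by (simp add: L1_def circle_times.abs_eq)

lemma defect_fps_L1_funpow:
  assumes "l > 0"
  shows "defect_fps l (\<lambda>x. (L1 l ^^ m) \<mu> (to_circle x)) x
    = (fps_X - 1) ^ m * defect_fps l (\<lambda>x. \<mu> (to_circle x)) x"
proof (induction m)
  case (Suc m)
  then show ?case
    using defect_fps_cohomological[OF assms, of "\<lambda>x. (L1 l ^^ m) \<mu> (to_circle x)" x]
    by (simp add: L1_to_circle circle_lift_periodic mult.assoc)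
qed simp

text \<open>At each point of the line, an \<open>m\<close>-fold preimage supplies the quotient of
  the generating function of \<tau> by the \<open>m\<close>-th power of \<open>fps_X - 1\<close>. It
  converges beyond radius 1 because the preimage is Lipschitz.\<close>

theorem constant_if_L1_infinitely_divisible:
  assumes "l \<ge> 2" and div: "\<And>m. \<exists>\<mu>. lipschitz_fun \<mu> \<and> (L1 l ^^ m) \<mu> = \<tau>"
  shows "\<tau> constant_on UNIV"
proof -
  let ?f = "\<lambda>x. \<tau> (to_circle x)"
  have "defect_fps l ?f x = 0" for x
  proof (rule fps_eq_0_if_infinite_order_at_1)
    fix m
    obtain \<mu> C where \<mu>: "C-lipschitz_on UNIV \<mu>" "(L1 l ^^ m) \<mu> = \<tau>"
      using div[of m] by (auto simp: lipschitz_fun_def)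
    have "fps_conv_radius (defect_fps l (\<lambda>x. \<mu> (to_circle x)) x) > 1"
      by (rule defect_fps_conv_radius[OF assms(1) circle_lift_lipschitz[OF \<mu>(1)]])
    moreover have "defect_fps l ?f x
        = (fps_X - 1) ^ m * defect_fps l (\<lambda>x. \<mu> (to_circle x)) x"
      using defect_fps_L1_funpow[of l m \<mu> x] assms(1) \<mu>(2) by simp
    ultimately show "\<exists>G. fps_conv_radius G > 1 \<and> defect_fps l ?f x = (fps_X - 1) ^ m * G"
      by blast
  qed
  then have zero: "transfer_defect l ?f x k = 0" for x k
    by (simp add: defect_fps_def fps_eq_iff)
  \<comment> \<open>The case of zero iterations says that \<tau> itself is Lipschitz.\<close>
  obtain C where "C-lipschitz_on UNIV \<tau>"
    using div[of 0] by (auto simp: lipschitz_fun_def)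
  then have "?f x = ?f y" for x y
    using constant_if_transfer_defect_0[where f = ?f, OF assms(1) circle_lift_lipschitz
        circle_lift_periodic zero] by blast
  then have "\<tau> p = ?f 0" for p
    by (cases p rule: to_circle_cases) simp
  then show ?thesis
    unfolding constant_on_def by blast
qed

section \<open>Normalising the mean, and taking preimages indefinitely\<close>

lemma lipschitz_fun_diff_const:
  fixes \<mu> :: "'a :: metric_space \<Rightarrow> real"
  assumes "lipschitz_fun \<mu>"
  shows "lipschitz_fun (\<lambda>\<theta>. \<mu> \<theta> - c)"
  using assms unfolding lipschitz_fun_def lipschitz_on_def by (simp add: dist_real_def)

lemma integral_circle_diff_const:
  fixes \<mu> :: "circle \<Rightarrow> real"
  assumes "lipschitz_fun \<mu>"
  shows "(LINT \<theta>|circle_lebesgue. \<mu> \<theta> - c) = (LINT \<theta>|circle_lebesgue. \<mu> \<theta>) - c"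
proof -
  obtain C where C: "C-lipschitz_on UNIV \<mu>"
    using assms by (auto simp: lipschitz_fun_def)
  have meas: "\<mu> \<in> borel_measurable borel"
    by (intro borel_measurable_continuous_onI lipschitz_on_continuous_on[OF C])
  have "continuous_on UNIV (\<lambda>x. \<mu> (to_circle x))"
    by (rule lipschitz_on_continuous_on[OF circle_lift_lipschitz[OF C]])
  \<comment> \<open>Continuity gives integrability on the compact interval; the half-open
    fundamental domain inherits it.\<close>
  then have "set_integrable lborel {0..1} (\<lambda>x. \<mu> (to_circle x))"
    by (rule borel_integrable_atLeastAtMost'[OF continuous_on_subset]) simp
  then have int: "set_integrable lborel {0..<1} (\<lambda>x. \<mu> (to_circle x))"
    by (rule set_integrable_subset) auto
  have "set_integrable lborel {0..<1::real} (\<lambda>_. c)"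
    unfolding set_integrable_def by simp
  then have "(LINT x:{0..<1}|lborel. \<mu> (to_circle x) - c)
      = (LINT x:{0..<1}|lborel. \<mu> (to_circle x)) - (LINT x:{0..<1::real}|lborel. c)"
    by (rule set_integral_diff(2)[OF int])
  also have "(LINT x:{0..<1::real}|lborel. c) = c"
    unfolding set_lebesgue_integral_def by simp
  finally show ?thesis
    using meas by (simp add: integral_circle_lebesgue)
qed

theorem lemma5p7:
  fixes l :: nat and \<tau> :: "circle \<Rightarrow> real"
  assumes "l \<ge> 2"
    and "lipschitz_fun \<tau>"
    and "\<not> \<tau> constant_on UNIV"
    and "(LINT \<theta>|circle_lebesgue. \<tau> \<theta>) = 0"
  shows "\<exists>(m :: nat) (\<mu> :: circle \<Rightarrow> real).
    lipschitz_fun \<mu> \<and> (L1 l ^^ m) \<mu> = \<tau> \<and> (LINT \<theta>|circle_lebesgue. \<mu> \<theta>) = 0 \<and>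
    (\<forall>\<rho> :: circle \<Rightarrow> real. lipschitz_fun \<rho> \<longrightarrow> L1 l \<rho> \<noteq> \<mu>)"
proof (rule ccontr)
  assume contr: "\<not> ?thesis"
  \<comment> \<open>If the claim fails, every Lipschitz \<open>m\<close>-fold preimage of \<tau>
    with mean 0 is again in the image of \<open>L1 l\<close> on Lipschitz functions, so preimages
    can be taken forever.\<close>
  have "\<exists>\<mu>. lipschitz_fun \<mu> \<and> (L1 l ^^ m) \<mu> = \<tau> \<and> (LINT \<theta>|circle_lebesgue. \<mu> \<theta>) = 0" for m
  proof (induction m)
    case 0
    show ?case using assms(2,4) by (intro exI[of _ \<tau>]) simp
  next
    case (Suc m)
    then obtain \<mu> \<rho> where \<rho>: "(L1 l ^^ m) \<mu> = \<tau>" "lipschitz_fun \<rho>" "L1 l \<rho> = \<mu>"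
      using contr by blast
    \<comment> \<open>The preimage \<rho> may have nonzero mean. As \<open>L1 l\<close> kills
      constants and the circle has total mass 1, subtracting the mean restores the induction
      hypothesis.\<close>
    define \<rho>' where "\<rho>' = (\<lambda>\<theta>. \<rho> \<theta> - (LINT \<theta>|circle_lebesgue. \<rho> \<theta>))"
    have "L1 l \<rho>' = \<mu>"
      using \<rho>(3) by (simp add: \<rho>'_def L1_def)
    then have "(L1 l ^^ Suc m) \<rho>' = \<tau>"
      using \<rho>(1) by (simp add: funpow_Suc_right del: funpow.simps)
    moreover have "lipschitz_fun \<rho>'"
      unfolding \<rho>'_def by (rule lipschitz_fun_diff_const[OF \<rho>(2)])
    moreover have "(LINT \<theta>|circle_lebesgue. \<rho>' \<theta>) = 0"
      unfolding \<rho>'_def by (simp add: integral_circle_diff_const[OF \<rho>(2)])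
    ultimately show ?case by blast
  qed
  then have "\<tau> constant_on UNIV"
    by (intro constant_if_L1_infinitely_divisible[OF assms(1)]) blast
  with assms(3) show False by simp
qed

end
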